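(* Let $S\neq\mathbb{N}$ be a numerical semigroup with maximal ideal $M=S\setminus\{0\}$. For all $a\in\mathbb{N}$ with $a\in M-2M$, $S$ is nearly Gorenstein if and only if the dilatation $S+a$ is nearly Gorenstein.
   Context: $\mathbb{N}$ denotes the nonnegative integers. A numerical semigroup $S$ is a submonoid of $(\mathbb{N},+)$ with $\mathbb{N}\setminus S$ finite; its maximal ideal is $M=S\setminus\{0\}$. For sets of integers $A,B$, put $A+B=\{x+y : x\in A, y\in B\}$ and $A-B=\{z\in\mathbb{Z} : z+B\subseteq A\}$; $2M=M+M$. So $a\in M-2M$ means $a+s_1+s_2\in M$ for all $s_1,s_2\in M$. For such $a\in\mathbb{N}$, the dilatation of $S$ with respect to $a$ is the numerical semigroup $S+a=\{0\}\cup\{s+a : s\in M\}$ (so here $S+a$ is not the full translate of $S$). $F(S)=\max(\mathbb{N}\setminus S)$ is the Frobenius number, and the canonical ideal of $S$ is $\Omega_S=\{x\in\mathbb{N} : F(S)-x\notin S\}$. The trace ideal of $S$ is $\mathrm{tr}(S)=\Omega_S+(S-\Omega_S)$. $S$ is nearly Gorenstein if $M\subseteq\mathrm{tr}(S)$. *)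

theory Defs
  imports Main "HOL-Library.Set_Algebras"
begin

text \<open>
  Numerical semigroups are sets of integers contained in the nonnegative integers \<open>{0..}\<close>, because
  differences of ideals live in the integers. On sets, \<open>A + B\<close> is the elementwise sum and
  \<open>z +o B\<close> the translate of \<open>B\<close> by \<open>z\<close> (both from \<open>Set_Algebras\<close>), while \<open>A - B\<close> is set
  difference; the difference of ideals is therefore written \<open>colon A B\<close>.
\<close>

definition numerical_semigroup :: "int set \<Rightarrow> bool" where
  "numerical_semigroup S \<longleftrightarrow>
     S \<subseteq> {0..} \<and> 0 \<in> S \<and> (\<forall>x\<in>S. \<forall>y\<in>S. x + y \<in> S) \<and> finite ({0..} - S)"

definition maximal_ideal :: "int set \<Rightarrow> int set" where
  "maximal_ideal S = S - {0}"

definition colon :: "int set \<Rightarrow> int set \<Rightarrow> int set" where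
  "colon A B = {z. z +o B \<subseteq> A}"

text \<open>As in the usual definition by a maximum, the value is unspecified for \<open>S = {0..}\<close>.\<close>

definition frobenius :: "int set \<Rightarrow> int" where
  "frobenius S = Max ({0..} - S)"

definition canonical_ideal :: "int set \<Rightarrow> int set" where
  "canonical_ideal S = {x. 0 \<le> x \<and> frobenius S - x \<notin> S}"

definition trace_ideal :: "int set \<Rightarrow> int set" where
  "trace_ideal S = canonical_ideal S + colon S (canonical_ideal S)"

definition nearly_gorenstein :: "int set \<Rightarrow> bool" where
  "nearly_gorenstein S \<longleftrightarrow> maximal_ideal S \<subseteq> trace_ideal S"

text \<open>Only the maximal ideal is translated; \<open>0\<close> stays in place.\<close>

definition dilatation :: "int set \<Rightarrow> int \<Rightarrow> int set" where
  "dilatation S a = {0} \<union> {s + a | s. s \<in> maximal_ideal S}"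

lemma numerical_semigroup_dilatation:
  assumes S: "numerical_semigroup S" and "0 \<le> a"
    and a: "a \<in> colon (maximal_ideal S) (maximal_ideal S + maximal_ideal S)"
  shows "numerical_semigroup (dilatation S a)"
proof -
  let ?M = "maximal_ideal S"
  have M: "a + (s + t) \<in> ?M" if "s \<in> ?M" "t \<in> ?M" for s t
    using a that by (auto simp: colon_def elt_set_plus_def set_plus_def)
  have closed: "\<exists>u. s + a + (t + a) = u + a \<and> u \<in> ?M" if "s \<in> ?M" "t \<in> ?M" for s t
    by (rule exI[of _ "a + (s + t)"]) (use M that in auto)
  have "{0..} - dilatation S a \<subseteq> {0..a} \<union> (+) a ` ({0..} - S)"
  proof
    fix x assume x: "x \<in> {0..} - dilatation S a"
    have "x - a \<notin> ?M"
    proof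
      assume "x - a \<in> ?M"
      then have "\<exists>s. x = s + a \<and> s \<in> ?M" by (intro exI[of _ "x - a"]) simp
      with x show False by (simp add: dilatation_def)
    qed
    then have "x \<in> {0..a} \<or> x - a \<in> {0..} - S"
      using x by (auto simp: maximal_ideal_def)
    then show "x \<in> {0..a} \<union> (+) a ` ({0..} - S)"
      by (metis Un_iff add_diff_cancel_left' diff_add_cancel add.commute image_eqI)
  qed
  moreover have "finite ({0..a} \<union> (+) a ` ({0..} - S))"
    using S by (simp add: numerical_semigroup_def)
  ultimately have "finite ({0..} - dilatation S a)" by (rule finite_subset)
  moreover have "dilatation S a \<subseteq> {0..}"
    using S \<open>0 \<le> a\<close> by (auto simp: numerical_semigroup_def dilatation_def maximal_ideal_def)
  moreover have "\<forall>x\<in>dilatation S a. \<forall>y\<in>dilatation S a. x + y \<in> dilatation S a"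
    using closed by (auto simp: dilatation_def)
  ultimately show ?thesis by (simp add: numerical_semigroup_def dilatation_def)
qed

end

theory Submission
  imports Defs
begin

text \<open>
  Let \<open>M\<close> be the maximal ideal of \<open>S\<close>, \<open>\<Omega>\<close> its canonical ideal, \<open>F\<close> its Frobenius number and
  \<open>D = M - \<Omega>\<close>. Then \<open>S\<close> is nearly Gorenstein iff \<open>M \<subseteq> \<Omega> + D\<close>, also in the symmetric case. For
  \<open>a > 0\<close> the dilatation \<open>T = S + a\<close> has Frobenius number \<open>F + a\<close>, canonical ideal
  \<open>(\<Omega> \<union> {F}) \<setminus> {F + a}\<close> and satisfies \<open>T - \<Omega>\<^sub>T = a + D\<close>; hence \<open>T\<close> is nearly Gorenstein iff
  \<open>M \<subseteq> ((\<Omega> \<union> {F}) \<setminus> {F + a}) + D\<close>. The elements \<open>F\<close> and \<open>F + a\<close> are irrelevant here: a sum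
  \<open>m\<close> of one of them with an element of \<open>D\<close> exceeds \<open>F\<close>, so that \<open>m \<in> D\<close> and \<open>m = 0 + m\<close>.
\<close>

lemma mem_colon_iff: "z \<in> colon A B \<longleftrightarrow> (\<forall>b\<in>B. z + b \<in> A)"
  by (auto simp: colon_def elt_set_plus_def)

lemma mem_set_plus_iff: "m \<in> A + B \<longleftrightarrow> (\<exists>w\<in>A. m - w \<in> B)" for m :: int
  by (force simp: set_plus_def)

lemma maximal_ideal_pos:
  assumes "numerical_semigroup S" "s \<in> maximal_ideal S"
  shows "0 < s"
  using assms by (fastforce simp: numerical_semigroup_def maximal_ideal_def)

text \<open>As \<open>S \<noteq> {0..}\<close>, the set of gaps is nonempty, so the maximum defining
  \<open>frobenius S\<close> is attained; it is not \<open>0\<close> because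
  \<open>0 \<in> S\<close>.\<close>

lemma
  assumes "numerical_semigroup S" "S \<noteq> {0..}"
  shows frobenius_pos: "0 < frobenius S"
    and frobenius_notin: "frobenius S \<notin> S"
    and frobenius_less_imp_mem: "frobenius S < x \<Longrightarrow> x \<in> S"
proof -
  have fin: "finite ({0..} - S)" and ne: "{0..} - S \<noteq> {}" and "0 \<in> S"
    using assms by (auto simp: numerical_semigroup_def)
  have F: "frobenius S \<in> {0..} - S"
    unfolding frobenius_def by (rule Max_in[OF fin ne])
  then show "frobenius S \<notin> S" by simp
  then show pos: "0 < frobenius S" using F \<open>0 \<in> S\<close> by (cases "frobenius S = 0") auto
  show "x \<in> S" if "frobenius S < x"
    using Max_ge[OF fin, of x] that pos by (fastforce simp: frobenius_def)
qed

lemma add_in_maximal_ideal: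
  assumes "numerical_semigroup S" "S \<noteq> {0..}" "y \<in> maximal_ideal S" "frobenius S \<le> w"
  shows "y + w \<in> maximal_ideal S"
  using frobenius_less_imp_mem[of S "y + w"] maximal_ideal_pos[of S y] frobenius_pos[of S] assms
  by (simp add: maximal_ideal_def)

lemma frobenius_eqI:
  assumes "numerical_semigroup S" "0 \<le> f" "f \<notin> S" "\<And>x. f < x \<Longrightarrow> x \<in> S"
  shows "frobenius S = f"
  unfolding frobenius_def
proof (rule Max_eqI)
  show "finite ({0..} - S)" using assms(1) by (simp add: numerical_semigroup_def)
  show "f \<in> {0..} - S" using assms by simp
  show "y \<le> f" if "y \<in> {0..} - S" for y using assms(4)[of y] that by fastforce
qed

lemma zero_in_canonical_ideal:
  assumes "numerical_semigroup S" "S \<noteq> {0..}"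
  shows "0 \<in> canonical_ideal S"
  using frobenius_notin[OF assms] by (simp add: canonical_ideal_def)

lemma gt_frobenius_in_colon:
  assumes "numerical_semigroup S" "S \<noteq> {0..}" "frobenius S < m"
  shows "m \<in> colon (maximal_ideal S) (canonical_ideal S)"
  using frobenius_less_imp_mem[OF assms(1,2)] frobenius_pos[OF assms(1,2)] assms(3)
  by (auto simp: mem_colon_iff maximal_ideal_def canonical_ideal_def)

lemma colon_canonical_subset_maximal_ideal:
  assumes "numerical_semigroup S" "S \<noteq> {0..}"
  shows "colon (maximal_ideal S) (canonical_ideal S) \<subseteq> maximal_ideal S"
  using zero_in_canonical_ideal[OF assms] by (force simp: mem_colon_iff)

text \<open>Since \<open>0\<close> is in the canonical ideal, \<open>d \<in> S\<close>, so
  \<open>d \<ge> 0\<close>. If \<open>d > 0\<close>, all sums \<open>d + w\<close> are positive and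
  hence avoid \<open>0\<close>.\<close>

lemma colon_canonical_cases:
  assumes S: "numerical_semigroup S" "S \<noteq> {0..}"
    and d: "d \<in> colon S (canonical_ideal S)"
  shows "d = 0 \<or> d \<in> colon (maximal_ideal S) (canonical_ideal S)"
proof -
  have "d \<in> S"
    using d zero_in_canonical_ideal[OF S] by (force simp: mem_colon_iff)
  then have "0 \<le> d" using S by (auto simp: numerical_semigroup_def)
  then show ?thesis
    using d by (fastforce simp: mem_colon_iff maximal_ideal_def canonical_ideal_def)
qed

text \<open>Replacing \<open>S\<close> by its maximal ideal in the colon can only lose the element
  \<open>0\<close>. This matters only when \<open>0\<close> was there, and then both sides of the
  equivalence are true.\<close>

lemma nearly_gorenstein_iff:
  assumes S: "numerical_semigroup S" "S \<noteq> {0..}"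
  shows "nearly_gorenstein S \<longleftrightarrow>
    maximal_ideal S \<subseteq> canonical_ideal S + colon (maximal_ideal S) (canonical_ideal S)"
    (is "_ \<longleftrightarrow> ?M \<subseteq> ?W + ?D")
proof -
  have sub: "?D \<subseteq> colon S ?W" by (auto simp: mem_colon_iff maximal_ideal_def)
  show ?thesis
  proof (cases "0 \<in> colon S ?W")
    \<comment> \<open>This is the symmetric case: the canonical ideal lies in \<open>S\<close>, so
      every element of \<open>?M\<close> is already in \<open>?D\<close> and is written as
      \<open>0 + m\<close>.\<close>
    case True
    then have W_sub: "?W \<subseteq> S" by (auto simp: mem_colon_iff)
    have "m \<in> ?D" if "m \<in> ?M" for m
    proof -
      have "m + w \<in> ?M" if "w \<in> ?W" for w
      proof -
        have "m + w \<in> S" using S \<open>m \<in> ?M\<close> that W_sub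
          by (auto simp: numerical_semigroup_def maximal_ideal_def)
        moreover have "0 < m + w" using maximal_ideal_pos[OF S(1) \<open>m \<in> ?M\<close>] that
          by (simp add: canonical_ideal_def)
        ultimately show ?thesis by (simp add: maximal_ideal_def)
      qed
      then show ?thesis by (simp add: mem_colon_iff)
    qed
    then have "?M \<subseteq> ?W + ?D"
      using set_plus_intro[OF zero_in_canonical_ideal[OF S]] by fastforce
    then show ?thesis
      unfolding nearly_gorenstein_def trace_ideal_def
      using sub by (meson order_trans set_plus_mono2 order_refl)
  next
    case False
    then have "colon S ?W = ?D"
      using colon_canonical_cases[OF S] sub by blast
    then show ?thesis by (simp add: nearly_gorenstein_def trace_ideal_def)
  qed
qed

context
  fixes S :: "int set" and a :: int
  assumes S: "numerical_semigroup S" "S \<noteq> {0..}"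
    and a_pos: "0 < a"
    and a: "a \<in> colon (maximal_ideal S) (maximal_ideal S + maximal_ideal S)"
begin

lemma mem_dilatation_iff: "x \<in> dilatation S a \<longleftrightarrow> x = 0 \<or> x - a \<in> maximal_ideal S"
  unfolding dilatation_def by (force intro: exI[of _ "x - a"])

lemma maximal_ideal_dilatation: "x \<in> maximal_ideal (dilatation S a) \<longleftrightarrow> x - a \<in> maximal_ideal S"
  using maximal_ideal_pos[OF S(1), of "x - a"] a_pos
  by (auto simp: maximal_ideal_def[of "dilatation S a"] mem_dilatation_iff)

lemma numerical_semigroup_dilatation': "numerical_semigroup (dilatation S a)"
  using numerical_semigroup_dilatation[OF S(1) _ a] a_pos by simp

lemma frobenius_dilatation: "frobenius (dilatation S a) = frobenius S + a"
  using frobenius_pos[OF S] frobenius_notin[OF S] frobenius_less_imp_mem[OF S] a_pos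
  by (intro frobenius_eqI numerical_semigroup_dilatation')
    (auto simp: mem_dilatation_iff maximal_ideal_def)

lemma dilatation_neq: "dilatation S a \<noteq> {0..}"
proof -
  have "a \<notin> dilatation S a" using a_pos by (simp add: mem_dilatation_iff maximal_ideal_def)
  then show ?thesis using a_pos by auto
qed

text \<open>Both corrections come from the untranslated \<open>0\<close>:
  \<open>x = frobenius S\<close> enters because \<open>0\<close> is missing from the translated set,
  and \<open>x = frobenius S + a\<close> leaves because \<open>0\<close> remains in the
  dilatation.\<close>

lemma canonical_ideal_dilatation:
  "canonical_ideal (dilatation S a) =
     insert (frobenius S) (canonical_ideal S) - {frobenius S + a}"
  using frobenius_pos[OF S] a_pos
  by (auto simp: canonical_ideal_def frobenius_dilatation mem_dilatation_iff maximal_ideal_def)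

text \<open>The two canonical ideals differ only in elements that are at least
  \<open>frobenius S\<close>. Testing at \<open>0\<close> gives
  \<open>z - a \<in> maximal_ideal S\<close>, and adding such an element to this positive number
  exceeds \<open>frobenius S\<close>, so those conditions hold automatically.\<close>

lemma colon_dilatation:
  "z \<in> colon (maximal_ideal (dilatation S a)) (canonical_ideal (dilatation S a)) \<longleftrightarrow>
   z - a \<in> colon (maximal_ideal S) (canonical_ideal S)" (is "?L \<longleftrightarrow> ?R")
proof
  assume ?L
  then have L: "z - a + w \<in> maximal_ideal S"
    if "w \<in> insert (frobenius S) (canonical_ideal S)" "w \<noteq> frobenius S + a" for w
    using that
    by (auto simp: mem_colon_iff maximal_ideal_dilatation canonical_ideal_dilatation algebra_simps)
  then have y: "z - a \<in> maximal_ideal S"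
    using L[of 0] zero_in_canonical_ideal[OF S] frobenius_pos[OF S] a_pos by simp
  show ?R
    unfolding mem_colon_iff
  proof
    fix w assume "w \<in> canonical_ideal S"
    then show "z - a + w \<in> maximal_ideal S"
      using L[of w] add_in_maximal_ideal[OF S y, of w] a_pos by (cases "w = frobenius S + a") auto
  qed
next
  assume R: ?R
  then have y: "z - a \<in> maximal_ideal S"
    using colon_canonical_subset_maximal_ideal[OF S] by blast
  show ?L
    unfolding mem_colon_iff maximal_ideal_dilatation canonical_ideal_dilatation
    using R add_in_maximal_ideal[OF S y, of "frobenius S"] by (auto simp: mem_colon_iff algebra_simps)
qed

lemma nearly_gorenstein_dilatation_iff:
  "nearly_gorenstein (dilatation S a) \<longleftrightarrow> nearly_gorenstein S"
proof -
  let ?F = "frobenius S" and ?M = "maximal_ideal S" and ?W = "canonical_ideal S"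
  let ?D = "colon ?M ?W" and ?V = "canonical_ideal (dilatation S a)"
  have "nearly_gorenstein (dilatation S a) \<longleftrightarrow> (\<forall>m\<in>?M. \<exists>w\<in>?V. m - w \<in> ?D)"
  proof -
    have "nearly_gorenstein (dilatation S a) \<longleftrightarrow>
        (\<forall>x. x - a \<in> ?M \<longrightarrow> (\<exists>w\<in>?V. x - w - a \<in> ?D))"
      unfolding nearly_gorenstein_iff[OF numerical_semigroup_dilatation' dilatation_neq]
        subset_iff maximal_ideal_dilatation mem_set_plus_iff colon_dilatation ..
    \<comment> \<open>Substitution \<open>x = m + a\<close>: the shift of the maximal ideal cancels
      against the shift of the colon.\<close>
    also have "\<dots> \<longleftrightarrow> (\<forall>m. m + a - a \<in> ?M \<longrightarrow> (\<exists>w\<in>?V. m + a - w - a \<in> ?D))"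
      by (metis diff_add_cancel)
    also have "\<dots> \<longleftrightarrow> (\<forall>m\<in>?M. \<exists>w\<in>?V. m - w \<in> ?D)"
      by (simp add: Ball_def)
    finally show ?thesis .
  qed
  also have "\<dots> \<longleftrightarrow> (\<forall>m\<in>?M. \<exists>w\<in>?W. m - w \<in> ?D)"
  proof (rule ball_cong[OF refl])
    fix m
    have "0 \<in> ?W" "0 \<in> ?V"
      using zero_in_canonical_ideal S numerical_semigroup_dilatation' dilatation_neq by auto
    moreover have "m \<in> ?D" if "m - w \<in> ?D" "?F \<le> w" for w
      using gt_frobenius_in_colon[OF S, of m] maximal_ideal_pos[OF S(1), of "m - w"]
        colon_canonical_subset_maximal_ideal[OF S] that by fastforce
    \<comment> \<open>A witness below \<open>?F\<close> thus serves for both ideals, and any other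
      is replaced by \<open>0\<close>.\<close>
    moreover have "w \<in> ?W \<longleftrightarrow> w \<in> ?V" if "w < ?F" for w
      using that a_pos by (auto simp: canonical_ideal_dilatation)
    ultimately show "(\<exists>w\<in>?V. m - w \<in> ?D) \<longleftrightarrow> (\<exists>w\<in>?W. m - w \<in> ?D)"
      by (metis diff_zero not_le)
  qed
  also have "\<dots> \<longleftrightarrow> nearly_gorenstein S"
    by (auto simp: nearly_gorenstein_iff[OF S] subset_iff mem_set_plus_iff)
  finally show ?thesis .
qed

end

theorem corollary3p9:
  fixes S :: "int set" and a :: int
  assumes "numerical_semigroup S"
    and "S \<noteq> {0..}"
    and "0 \<le> a"
    and "a \<in> colon (maximal_ideal S) (maximal_ideal S + maximal_ideal S)"
  shows "nearly_gorenstein S \<longleftrightarrow> nearly_gorenstein (dilatation S a)"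
proof (cases "a = 0")
  case True
  have "dilatation S 0 = S"
    using assms(1) by (auto simp: dilatation_def maximal_ideal_def numerical_semigroup_def)
  with True show ?thesis by simp
next
  case False
  with assms show ?thesis using nearly_gorenstein_dilatation_iff by simp
qed

end
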